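(* The solution to the differential equation $$\rho''-\frac{1}{45}Q\rho=0,$$ where $Q=P^2-6P'$ and $P$ is a solution to the generalised Chazy equation with parameter $k=\frac32$, is given by $\rho=\frac{u}{v}$, where $v$ is the solution to the second-order differential equation associated to the $k=\frac32$ generalised Chazy equation and $u$ is a solution to the second-order differential equation associated to the $k=3$ generalised Chazy equation.
   Context: Primes denote $\frac{d}{dx}$; $P$ and $\rho$ are functions of $x$. The generalised Chazy equation with parameter $k$ is $$y'''-2yy''+3y'^2-\frac{4}{36-k^2}(6y'-y^2)^2=0.$$ Its solution is given as follows. For constants $(\alpha,\beta,\gamma)$ let $$V=\frac{1-\beta^2}{s^2}+\frac{1-\gamma^2}{(s-1)^2}+\frac{\beta^2+\gamma^2-\alpha^2-1}{s(s-1)},$$ let $s=s(x)$ be a solution of the Schwarzian differential equation $\{s,x\}+\frac12(s')^2V=0$, where $\{s,x\}=\frac{d}{dx}\left(\frac{s''}{s'}\right)-\frac12\left(\frac{s''}{s'}\right)^2$, and put $$w_1=-\frac12\frac{d}{dx}\log\frac{s'}{s(s-1)},\quad w_2=-\frac12\frac{d}{dx}\log\frac{s'}{s-1},\quad w_3=-\frac12\frac{d}{dx}\log\frac{s'}{s}.$$ Then the generalised Chazy equation with parameter $k$ is solved by: - $y=-2w_1-2w_2-2w_3$ when $(\alpha,\beta,\gamma)=(\frac13,\frac13,\frac2k)$ or $(\frac2k,\frac2k,\frac2k)$; - $y=-w_1-2w_2-3w_3$ when $(\alpha,\beta,\gamma)=(\frac1k,\frac13,\frac12)$ or $(\frac1k,\frac2k,\frac12)$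 or $(\frac1k,\frac13,\frac3k)$; - $y=-w_1-w_2-4w_3$ when $(\alpha,\beta,\gamma)=(\frac1k,\frac1k,\frac4k)$ or $(\frac1k,\frac1k,\frac23)$; permutations of $w_1,w_2,w_3$ in $y$ correspond to permutations of the values $\alpha,\beta,\gamma$. The second-order differential equation associated to the generalised Chazy equation with parameter $k$ is $u_{ss}+\frac14Vu=0$, with the potential $V$ above and $(\alpha,\beta,\gamma)$ one of the triples above for that $k$. It corresponds to the Schwarzian differential equation after exchanging dependent and independent variables: $x=\frac{u_2}{u_1}$ with $u_1,u_2$ linearly independent solutions of $u_{ss}+\frac14Vu=0$. In the formula $\rho=\frac uv$, the functions $u$ and $v$ are regarded as functions of $x$ through $s=s(x)$. *)

theory Defs
  imports "HOL-Complex_Analysis.Complex_Analysis"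
begin

definition chazy_solution :: "complex \<Rightarrow> (complex \<Rightarrow> complex) \<Rightarrow> complex set \<Rightarrow> bool" where
  "chazy_solution k y D \<longleftrightarrow> y holomorphic_on D \<and>
     (\<forall>x\<in>D. (deriv ^^ 3) y x - 2 * y x * (deriv ^^ 2) y x + 3 * (deriv y x)\<^sup>2
            - 4 / (36 - k\<^sup>2) * (6 * deriv y x - (y x)\<^sup>2)\<^sup>2 = 0)"

definition potential :: "complex \<Rightarrow> complex \<Rightarrow> complex \<Rightarrow> complex \<Rightarrow> complex" where
  "potential \<alpha> \<beta> \<gamma> z =
     (1 - \<beta>\<^sup>2) / z\<^sup>2 + (1 - \<gamma>\<^sup>2) / (z - 1)\<^sup>2 + (\<beta>\<^sup>2 + \<gamma>\<^sup>2 - \<alpha>\<^sup>2 - 1) / (z * (z - 1))"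

definition schwarzian :: "(complex \<Rightarrow> complex) \<Rightarrow> complex \<Rightarrow> complex" where
  "schwarzian s x =
     deriv (\<lambda>t. deriv (deriv s) t / deriv s t) x - 1/2 * (deriv (deriv s) x / deriv s x)\<^sup>2"

text \<open>The side conditions \<open>s x \<noteq> 0\<close>, \<open>s x \<noteq> 1\<close> and \<open>s' \<noteq> 0\<close> say that all terms of the
  Schwarzian equation are defined; without them division by zero would return 0.\<close>

definition schwarz_solution ::
    "complex \<Rightarrow> complex \<Rightarrow> complex \<Rightarrow> (complex \<Rightarrow> complex) \<Rightarrow> complex set \<Rightarrow> bool" where
  "schwarz_solution \<alpha> \<beta> \<gamma> s D \<longleftrightarrow> s holomorphic_on D \<and>
     (\<forall>x\<in>D. s x \<noteq> 0 \<and> s x \<noteq> 1 \<and> deriv s x \<noteq> 0 \<and>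
            schwarzian s x + 1/2 * (deriv s x)\<^sup>2 * potential \<alpha> \<beta> \<gamma> (s x) = 0)"

text \<open>The derivative of \<open>log f\<close>, independent of the choice of a branch of the logarithm.\<close>

definition dlog :: "(complex \<Rightarrow> complex) \<Rightarrow> complex \<Rightarrow> complex" where
  "dlog f x = deriv f x / f x"

definition w1 :: "(complex \<Rightarrow> complex) \<Rightarrow> complex \<Rightarrow> complex" where
  "w1 s x = - 1/2 * dlog (\<lambda>t. deriv s t / (s t * (s t - 1))) x"

definition w2 :: "(complex \<Rightarrow> complex) \<Rightarrow> complex \<Rightarrow> complex" where
  "w2 s x = - 1/2 * dlog (\<lambda>t. deriv s t / (s t - 1)) x"

definition w3 :: "(complex \<Rightarrow> complex) \<Rightarrow> complex \<Rightarrow> complex" where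
  "w3 s x = - 1/2 * dlog (\<lambda>t. deriv s t / s t) x"

text \<open>\<open>chazy_data a b c \<alpha> \<beta> \<gamma>\<close>: for \<open>k \<noteq> 0\<close>, \<open>k\<^sup>2 \<noteq> 36\<close>, the generalised Chazy equation with parameter
  \<open>k\<close> is solved by \<open>y = - a w1 - b w2 - c w3\<close> when \<open>s\<close> solves the Schwarzian equation with
  constants \<open>(\<alpha> k, \<beta> k, \<gamma> k)\<close>. The constants are kept as functions of \<open>k\<close>, so that the
  triples belonging to two different parameters can be taken from the same entry.
  The swap rules permute \<open>w1, w2, w3\<close> and \<open>\<alpha>, \<beta>, \<gamma>\<close> simultaneously.\<close>

inductive chazy_data ::
    "complex \<Rightarrow> complex \<Rightarrow> complex \<Rightarrow>
     (complex \<Rightarrow> complex) \<Rightarrow> (complex \<Rightarrow> complex) \<Rightarrow> (complex \<Rightarrow> complex) \<Rightarrow> bool" where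
  "chazy_data 2 2 2 (\<lambda>k. 1/3) (\<lambda>k. 1/3) (\<lambda>k. 2/k)"
| "chazy_data 2 2 2 (\<lambda>k. 2/k) (\<lambda>k. 2/k) (\<lambda>k. 2/k)"
| "chazy_data 1 2 3 (\<lambda>k. 1/k) (\<lambda>k. 1/3) (\<lambda>k. 1/2)"
| "chazy_data 1 2 3 (\<lambda>k. 1/k) (\<lambda>k. 2/k) (\<lambda>k. 1/2)"
| "chazy_data 1 2 3 (\<lambda>k. 1/k) (\<lambda>k. 1/3) (\<lambda>k. 3/k)"
| "chazy_data 1 1 4 (\<lambda>k. 1/k) (\<lambda>k. 1/k) (\<lambda>k. 4/k)"
| "chazy_data 1 1 4 (\<lambda>k. 1/k) (\<lambda>k. 1/k) (\<lambda>k. 2/3)"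
| swap12: "chazy_data a b c \<alpha> \<beta> \<gamma> \<Longrightarrow> chazy_data b a c \<beta> \<alpha> \<gamma>"
| swap23: "chazy_data a b c \<alpha> \<beta> \<gamma> \<Longrightarrow> chazy_data a c b \<alpha> \<gamma> \<beta>"

text \<open>The second-order equation associated to the generalised Chazy equation, in the
  independent variable \<open>s\<close>.\<close>

definition assoc_solution ::
    "complex \<Rightarrow> complex \<Rightarrow> complex \<Rightarrow> (complex \<Rightarrow> complex) \<Rightarrow> complex set \<Rightarrow> bool" where
  "assoc_solution \<alpha> \<beta> \<gamma> u S \<longleftrightarrow> u holomorphic_on S \<and>
     (\<forall>z\<in>S. deriv (deriv u) z + 1/4 * potential \<alpha> \<beta> \<gamma> z * u z = 0)"

definition lin_indep_on :: "(complex \<Rightarrow> complex) \<Rightarrow> (complex \<Rightarrow> complex) \<Rightarrow> complex set \<Rightarrow> bool" where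
  "lin_indep_on f g S \<longleftrightarrow>
     (\<forall>c d. (\<forall>z\<in>S. c * f z + d * g z = 0) \<longrightarrow> c = 0 \<and> d = 0)"

text \<open>\<open>s\<close> is the local inverse of \<open>x = u2/u1\<close>, where \<open>u1\<close> and \<open>u2\<close> are linearly independent
  solutions of the associated second-order equation on the range of \<open>s\<close>; this forces \<open>s\<close>
  to be injective on \<open>D\<close>.\<close>

definition inverse_quotient ::
    "complex \<Rightarrow> complex \<Rightarrow> complex \<Rightarrow> (complex \<Rightarrow> complex) \<Rightarrow> (complex \<Rightarrow> complex) \<Rightarrow>
     (complex \<Rightarrow> complex) \<Rightarrow> complex set \<Rightarrow> bool" where
  "inverse_quotient \<alpha> \<beta> \<gamma> u1 u2 s D \<longleftrightarrow>
     assoc_solution \<alpha> \<beta> \<gamma> u1 (s ` D) \<and> assoc_solution \<alpha> \<beta> \<gamma> u2 (s ` D) \<and>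
     lin_indep_on u1 u2 (s ` D) \<and>
     (\<forall>x\<in>D. u1 (s x) \<noteq> 0 \<and> x = u2 (s x) / u1 (s x))"

end

theory Submission
  imports Defs
begin

text \<open>With \<open>x = u2/v\<close> and the constant Wronskian \<open>W\<close> of \<open>v, u2\<close> we have \<open>dx/ds = W/v\<^sup>2\<close>. Hence the
  substitution \<open>u = v \<rho>\<close> turns \<open>u\<^sub>s\<^sub>s + V\<^sub>3 u / 4\<close> into \<open>W\<^sup>2/v\<^sup>3 (\<rho>'' - (s')\<^sup>2 (V - V\<^sub>3) \<rho> / 4)\<close>,
  where \<open>V\<close> and \<open>V\<^sub>3\<close> are the potentials for \<open>k = 3/2\<close> and \<open>k = 3\<close>. On the other hand,
  the Schwarzian equation eliminates \<open>s'''\<close> from \<open>Q = P\<^sup>2 - 6 P'\<close>, the terms in \<open>s''\<close> cancel because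
  \<open>a + b + c = 6\<close>, and \<open>Q / (s')\<^sup>2\<close> becomes a combination of the partial fractions of \<open>V\<close> and \<open>V\<^sub>3\<close>.
  It equals \<open>45 (V - V\<^sub>3) / 4\<close> because each entry of the table
  satisfies \<open>a\<^sup>2 = 45 \<alpha>(3)\<^sup>2 - 9 \<alpha>(3/2)\<^sup>2\<close>.\<close>

section \<open>Numerical identities of the table\<close>

lemma chazy_data_sum:
  assumes "chazy_data a b c \<alpha> \<beta> \<gamma>"
  shows "a + b + c = 6"
  using assms by induction (auto simp: algebra_simps)

text \<open>A constant entry \<open>r\<close> contributes 36 r^2, an entry \<open>n/k\<close>
  contributes 5 n^2 - 4 n^2 = n^2. In the table the matching weight is 6 r or n respectively, and
  the swap rules move weights and constants together.\<close>

lemma chazy_data_squares: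
  assumes "chazy_data a b c \<alpha> \<beta> \<gamma>"
  shows "a\<^sup>2 = 45 * (\<alpha> 3)\<^sup>2 - 9 * (\<alpha> (3/2))\<^sup>2 \<and>
         b\<^sup>2 = 45 * (\<beta> 3)\<^sup>2 - 9 * (\<beta> (3/2))\<^sup>2 \<and>
         c\<^sup>2 = 45 * (\<gamma> 3)\<^sup>2 - 9 * (\<gamma> (3/2))\<^sup>2"
  using assms by induction (auto simp: power2_eq_square)

lemma deriv_holomorphic_has_field_derivative:
  assumes "f holomorphic_on S" "open S" "z \<in> S"
  shows "(f has_field_derivative deriv f z) (at z)"
    and "(deriv f has_field_derivative deriv (deriv f) z) (at z)"
  using assms by (auto intro!: holomorphic_derivI holomorphic_deriv)

lemma has_field_derivative_cong_open:
  assumes "(f has_field_derivative d) (at z)" "open S" "z \<in> S" "\<And>w. w \<in> S \<Longrightarrow> f w = g w"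
  shows "(g has_field_derivative d) (at z)"
  using assms has_field_derivative_transform_within_open by blast

text \<open>A second derivative at \<open>z\<close> depends on \<open>deriv f\<close> near
  \<open>z\<close>, so the formula for the first derivative is assumed on all of the open
  set.\<close>

lemma deriv_deriv_eq_open:
  assumes "\<And>w. w \<in> S \<Longrightarrow> (f has_field_derivative f' w) (at w)"
    and "(f' has_field_derivative d) (at z)" "open S" "z \<in> S"
  shows "deriv (deriv f) z = d"
  using has_field_derivative_cong_open[OF assms(2-4), of "deriv f"] assms(1)
  by (metis DERIV_imp_deriv)

section \<open>\<open>Q\<close> as a multiple of the difference of the two potentials\<close>

text \<open>Here \<open>z\<close>, \<open>d\<close>, \<open>p\<close> stand for s, s', s''/s'. All
  terms containing \<open>p\<close> cancel. The double poles match through A^2 - 6 A = b^2/4 - 9 and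
  its analogue for \<open>B\<close>, \<open>c\<close>; the mixed term matches through 2 A B - 9 =
  (a^2 - b^2 - c^2)/4.\<close>

lemma chazy_invariant_algebra:
  fixes a b c p d z al be ga al3 be3 ga3 :: complex
  assumes "a + b + c = 6" "z \<noteq> 0" "z \<noteq> 1"
    and sq: "a\<^sup>2 = 45 * al3\<^sup>2 - 9 * al\<^sup>2" "b\<^sup>2 = 45 * be3\<^sup>2 - 9 * be\<^sup>2" "c\<^sup>2 = 45 * ga3\<^sup>2 - 9 * ga\<^sup>2"
  defines "A \<equiv> 3 - b/2" and "B \<equiv> 3 - c/2"
  shows "(3 * p - A * (d/z) - B * (d/(z-1)))\<^sup>2
      - 6 * (3 * (1/2 * p\<^sup>2 - 1/2 * d\<^sup>2 * potential al be ga z)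
             - A * (p * d / z - d\<^sup>2/z\<^sup>2) - B * (p * d / (z-1) - d\<^sup>2/(z-1)\<^sup>2))
      = 45/4 * d\<^sup>2 * (potential al be ga z - potential al3 be3 ga3 z)"
proof -
  \<comment> \<open>Both sides become polynomials in \<open>r\<close> and \<open>t\<close> that
    agree coefficient by coefficient.\<close>
  define r t where "r = 1/z" and "t = 1/(z-1)"
  have pot: "potential x y w z = (1 - y\<^sup>2) * r\<^sup>2 + (1 - w\<^sup>2) * t\<^sup>2 + (y\<^sup>2 + w\<^sup>2 - x\<^sup>2 - 1) * (r*t)" for x y w
    by (simp add: potential_def r_def t_def power_divide)
  have *: "d/z = d*r" "d/(z-1) = d*t" "p*d/z = p*d*r" "p*d/(z-1) = p*d*t" "d\<^sup>2/z\<^sup>2 = d\<^sup>2*r\<^sup>2" "d\<^sup>2/(z-1)\<^sup>2 = d\<^sup>2*t\<^sup>2"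
    by (simp_all add: r_def t_def power_divide)
  have s3: "al3\<^sup>2 = (a\<^sup>2 + 9*al\<^sup>2)/45" "be3\<^sup>2 = (b\<^sup>2 + 9*be\<^sup>2)/45" "ga3\<^sup>2 = (c\<^sup>2 + 9*ga\<^sup>2)/45"
    using sq by simp_all
  have a: "a = 6 - b - c" using assms(1) by (simp add: algebra_simps)
  show ?thesis
    unfolding pot * s3 A_def B_def a
    by (simp add: field_simps power2_eq_square)
qed

lemma chazy_invariant:
  fixes D :: "complex set"
  assumes "open D" and data: "chazy_data a b c \<alpha> \<beta> \<gamma>"
    and sol: "schwarz_solution (\<alpha> (3/2)) (\<beta> (3/2)) (\<gamma> (3/2)) s D"
    and P: "\<And>x. x \<in> D \<Longrightarrow> P x = - a * w1 s x - b * w2 s x - c * w3 s x"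
    and "x \<in> D"
  shows "(P x)\<^sup>2 - 6 * deriv P x = 45/4 * (deriv s x)\<^sup>2 *
     (potential (\<alpha> (3/2)) (\<beta> (3/2)) (\<gamma> (3/2)) (s x) - potential (\<alpha> 3) (\<beta> 3) (\<gamma> 3) (s x))"
proof -
  define p where "p = (\<lambda>t. deriv (deriv s) t / deriv s t)"
  have hol: "s holomorphic_on D"
    and s0: "\<And>x. x \<in> D \<Longrightarrow> s x \<noteq> 0" "\<And>x. x \<in> D \<Longrightarrow> s x \<noteq> 1" "\<And>x. x \<in> D \<Longrightarrow> deriv s x \<noteq> 0"
    and sch: "\<And>x. x \<in> D \<Longrightarrow> schwarzian s x
        + 1/2 * (deriv s x)\<^sup>2 * potential (\<alpha> (3/2)) (\<beta> (3/2)) (\<gamma> (3/2)) (s x) = 0"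
    using sol by (auto simp: schwarz_solution_def)
  note ds = deriv_holomorphic_has_field_derivative[OF hol \<open>open D\<close>]
  have sum: "a = 6 - b - c"
    using chazy_data_sum[OF data] by (simp add: algebra_simps)
  have s1: "s x - 1 \<noteq> 0" if "x \<in> D" for x using s0(2)[OF that] by simp
  \<comment> \<open>The pole at s = 0 enters through \<open>w1\<close> and \<open>w3\<close>, hence
    with (a + c)/2 = 3 - b/2; the pole at s = 1 enters through \<open>w1\<close> and
    \<open>w2\<close>, hence with (a + b)/2 = 3 - c/2.\<close>
  have P': "P x = 3 * p x - (3 - b/2) * (deriv s x / s x) - (3 - c/2) * (deriv s x / (s x - 1))"
    if x: "x \<in> D" for x
  proof -
    note nz = s0[OF x] s1[OF x]
    have "((\<lambda>t. deriv s t / (s t * (s t - 1))) has_field_derivative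
        (p x - deriv s x / s x - deriv s x / (s x - 1)) * (deriv s x / (s x * (s x - 1)))) (at x)"
      using nz by (auto intro!: derivative_eq_intros ds[OF x]
          simp: p_def divide_simps) (simp add: algebra_simps)
    then have w1: "w1 s x = - 1/2 * (p x - deriv s x / s x - deriv s x / (s x - 1))"
      using nz by (simp add: w1_def dlog_def DERIV_imp_deriv)
    have "((\<lambda>t. deriv s t / (s t - 1)) has_field_derivative
        (p x - deriv s x / (s x - 1)) * (deriv s x / (s x - 1))) (at x)"
      using nz by (auto intro!: derivative_eq_intros ds[OF x]
          simp: p_def divide_simps)
    then have w2: "w2 s x = - 1/2 * (p x - deriv s x / (s x - 1))"
      using nz by (simp add: w2_def dlog_def DERIV_imp_deriv)
    have "((\<lambda>t. deriv s t / s t) has_field_derivative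
        (p x - deriv s x / s x) * (deriv s x / s x)) (at x)"
      using nz by (auto intro!: derivative_eq_intros ds[OF x]
          simp: p_def divide_simps)
    then have w3: "w3 s x = - 1/2 * (p x - deriv s x / s x)"
      using nz by (simp add: w3_def dlog_def DERIV_imp_deriv)
    define d e where "d = deriv s x / s x" and "e = deriv s x / (s x - 1)"
    show ?thesis
      unfolding P[OF x] w1 w2 w3 sum d_def[symmetric] e_def[symmetric]
      by (simp add: field_simps)
  qed
  note nz = s0[OF \<open>x \<in> D\<close>] s1[OF \<open>x \<in> D\<close>]
  have "p holomorphic_on D"
    unfolding p_def using hol s0 \<open>open D\<close> by (intro holomorphic_intros holomorphic_deriv) auto
  then have dp: "(p has_field_derivative deriv p x) (at x)"
    using \<open>open D\<close> \<open>x \<in> D\<close> by (rule holomorphic_derivI)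
  \<comment> \<open>Since {s,x} = p' - p^2/2, the Schwarzian equation gives p' without third
    derivatives of \<open>s\<close>.\<close>
  have p_deriv: "deriv p x = 1/2 * (p x)\<^sup>2
      - 1/2 * (deriv s x)\<^sup>2 * potential (\<alpha> (3/2)) (\<beta> (3/2)) (\<gamma> (3/2)) (s x)"
    using sch[OF \<open>x \<in> D\<close>] by (simp add: schwarzian_def p_def algebra_simps)
  have s2: "deriv (deriv s) x = p x * deriv s x" using nz by (simp add: p_def)
  have q0: "((\<lambda>t. deriv s t / s t) has_field_derivative
      p x * deriv s x / s x - (deriv s x)\<^sup>2 / (s x)\<^sup>2) (at x)"
    using nz by (auto intro!: derivative_eq_intros ds[OF \<open>x \<in> D\<close>]
          simp: s2 divide_simps power2_eq_square)
  have q1: "((\<lambda>t. deriv s t / (s t - 1)) has_field_derivative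
      p x * deriv s x / (s x - 1) - (deriv s x)\<^sup>2 / (s x - 1)\<^sup>2) (at x)"
    using nz by (auto intro!: derivative_eq_intros ds[OF \<open>x \<in> D\<close>]
          simp: s2 divide_simps power2_eq_square)
  have "((\<lambda>x. 3 * p x - (3 - b/2) * (deriv s x / s x) - (3 - c/2) * (deriv s x / (s x - 1)))
      has_field_derivative 3 * deriv p x
        - (3 - b/2) * (p x * deriv s x / s x - (deriv s x)\<^sup>2 / (s x)\<^sup>2)
        - (3 - c/2) * (p x * deriv s x / (s x - 1) - (deriv s x)\<^sup>2 / (s x - 1)\<^sup>2)) (at x)"
    by (intro DERIV_diff DERIV_cmult dp q0 q1)
  then have "deriv P x = 3 * deriv p x
        - (3 - b/2) * (p x * deriv s x / s x - (deriv s x)\<^sup>2 / (s x)\<^sup>2)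
        - (3 - c/2) * (p x * deriv s x / (s x - 1) - (deriv s x)\<^sup>2 / (s x - 1)\<^sup>2)"
    by (intro DERIV_imp_deriv, rule has_field_derivative_cong_open[OF _ \<open>open D\<close> \<open>x \<in> D\<close>])
      (auto simp: P')
  then show ?thesis
    using chazy_invariant_algebra[OF chazy_data_sum[OF data] nz(1,2)]
      chazy_data_squares[OF data]
    by (simp only: P'[OF \<open>x \<in> D\<close>] p_deriv)
qed

section \<open>Wronskian and change of the independent variable\<close>

text \<open>The equation has no first-order term and both solutions share one potential, so v w'' -
  w v'' = 0. The same Wronskian is the numerator in the quotient rule.\<close>

lemma assoc_quotient_derivative:
  assumes "open S" and v: "assoc_solution \<alpha> \<beta> \<gamma> v S" and w: "assoc_solution \<alpha> \<beta> \<gamma> w S"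
    and "z \<in> S" "v z \<noteq> 0"
  shows "((\<lambda>z. v z * deriv w z - w z * deriv v z) has_field_derivative 0) (at z)"
    and "((\<lambda>z. w z / v z) has_field_derivative
            (v z * deriv w z - w z * deriv v z) / (v z)\<^sup>2) (at z)"
proof -
  have hol: "v holomorphic_on S" "w holomorphic_on S"
    and eq: "deriv (deriv v) z = - (1/4 * potential \<alpha> \<beta> \<gamma> z * v z)"
            "deriv (deriv w) z = - (1/4 * potential \<alpha> \<beta> \<gamma> z * w z)"
    using v w \<open>z \<in> S\<close> by (auto simp: assoc_solution_def eq_neg_iff_add_eq_0)
  note d = hol[THEN deriv_holomorphic_has_field_derivative(1), OF \<open>open S\<close> \<open>z \<in> S\<close>]
    hol[THEN deriv_holomorphic_has_field_derivative(2), OF \<open>open S\<close> \<open>z \<in> S\<close>]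
  show "((\<lambda>z. v z * deriv w z - w z * deriv v z) has_field_derivative 0) (at z)"
    by (rule derivative_eq_intros d refl)+ (simp add: eq algebra_simps)
  show "((\<lambda>z. w z / v z) has_field_derivative
            (v z * deriv w z - w z * deriv v z) / (v z)\<^sup>2) (at z)"
    by (rule derivative_eq_intros d refl \<open>v z \<noteq> 0\<close>)+ (simp add: power2_eq_square algebra_simps)
qed

text \<open>With X' = W/v^2 the first derivative is v' \<rho> + \<rho>' W/v. Differentiating again,
  the two terms v' \<rho>' W/v^2 cancel because W' = 0, so no \<rho>' remains.\<close>

lemma deriv2_assoc_times_quotient:
  assumes "open S" "open D" and v: "assoc_solution \<alpha> \<beta> \<gamma> v S" and w: "assoc_solution \<alpha> \<beta> \<gamma> w S"
    and v0: "\<And>z. z \<in> S \<Longrightarrow> v z \<noteq> 0" and range: "\<And>z. z \<in> S \<Longrightarrow> w z / v z \<in> D"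
    and \<rho>: "\<rho> holomorphic_on D" and u: "\<And>z. z \<in> S \<Longrightarrow> u z = v z * \<rho> (w z / v z)"
    and "z \<in> S"
  shows "deriv (deriv u) z = deriv (deriv v) z * \<rho> (w z / v z)
    + deriv (deriv \<rho>) (w z / v z) * (v z * deriv w z - w z * deriv v z)\<^sup>2 / (v z)^3"
proof -
  define X where "X = (\<lambda>z. w z / v z)"
  define W where "W = (\<lambda>z. v z * deriv w z - w z * deriv v z)"
  have "v holomorphic_on S" using v by (simp add: assoc_solution_def)
  note dv = deriv_holomorphic_has_field_derivative[OF this \<open>open S\<close>]
  note dW = assoc_quotient_derivative(1)[OF \<open>open S\<close> v w _ v0, folded W_def]
  have dX: "(X has_field_derivative W z / (v z)\<^sup>2) (at z)" if "z \<in> S" for z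
    using assoc_quotient_derivative(2)[OF \<open>open S\<close> v w that v0[OF that]]
    by (simp add: X_def W_def)
  have d\<rho>: "((\<lambda>z. \<rho> (X z)) has_field_derivative deriv \<rho> (X z) * (W z / (v z)\<^sup>2)) (at z)"
    "((\<lambda>z. deriv \<rho> (X z)) has_field_derivative deriv (deriv \<rho>) (X z) * (W z / (v z)\<^sup>2)) (at z)"
    if "z \<in> S" for z
    using deriv_holomorphic_has_field_derivative[OF \<rho> \<open>open D\<close> range[OF that]]
    by (intro DERIV_chain2[OF _ dX[OF that]]; simp add: X_def)+
  have du: "(u has_field_derivative deriv v z * \<rho> (X z) + deriv \<rho> (X z) * (W z / v z)) (at z)"
    if z: "z \<in> S" for z
  proof (rule has_field_derivative_cong_open[OF _ \<open>open S\<close> z])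
    show "((\<lambda>z. v z * \<rho> (X z)) has_field_derivative
        deriv v z * \<rho> (X z) + deriv \<rho> (X z) * (W z / v z)) (at z)"
      by (rule derivative_eq_intros dv[OF z] d\<rho>[OF z] refl)+
        (simp add: v0[OF z] power2_eq_square)
  qed (simp add: u X_def)
  have ddu: "((\<lambda>z. deriv v z * \<rho> (X z) + deriv \<rho> (X z) * (W z / v z)) has_field_derivative
      deriv (deriv v) z * \<rho> (X z) + deriv (deriv \<rho>) (X z) * (W z)\<^sup>2 / (v z)^3) (at z)"
    by (rule derivative_eq_intros dv[OF \<open>z \<in> S\<close>] d\<rho>[OF \<open>z \<in> S\<close>] dW[OF \<open>z \<in> S\<close>] v0 \<open>z \<in> S\<close> refl)+
      (simp_all add: v0[OF \<open>z \<in> S\<close>] \<open>z \<in> S\<close> power2_eq_square power3_eq_cube field_simps)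
  have "deriv (deriv u) z =
      deriv (deriv v) z * \<rho> (X z) + deriv (deriv \<rho>) (X z) * (W z)\<^sup>2 / (v z)^3"
    by (rule deriv_deriv_eq_open[OF du ddu \<open>open S\<close> \<open>z \<in> S\<close>])
  then show ?thesis by (simp add: X_def W_def)
qed

section \<open>Equivalence of the two linear equations\<close>

theorem theorem3p1:
  fixes D :: "complex set"
    and P Q s v u2 :: "complex \<Rightarrow> complex"
    and a b c :: complex
    and \<alpha> \<beta> \<gamma> :: "complex \<Rightarrow> complex"
  assumes "open D" and "connected D"
    and "chazy_data a b c \<alpha> \<beta> \<gamma>"
    and "chazy_solution (3/2) P D"
    and "schwarz_solution (\<alpha> (3/2)) (\<beta> (3/2)) (\<gamma> (3/2)) s D"
    and "\<And>x. x \<in> D \<Longrightarrow> P x = - a * w1 s x - b * w2 s x - c * w3 s x"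
    and "inverse_quotient (\<alpha> (3/2)) (\<beta> (3/2)) (\<gamma> (3/2)) v u2 s D"
    and "\<And>x. x \<in> D \<Longrightarrow> Q x = (P x)\<^sup>2 - 6 * deriv P x"
  shows "\<forall>\<rho> :: complex \<Rightarrow> complex.
           (\<rho> holomorphic_on D \<and>
              (\<forall>x\<in>D. deriv (deriv \<rho>) x - 1/45 * Q x * \<rho> x = 0))
           \<longleftrightarrow>
           (\<exists>u. assoc_solution (\<alpha> 3) (\<beta> 3) (\<gamma> 3) u (s ` D) \<and>
                (\<forall>x\<in>D. \<rho> x = u (s x) / v (s x)))"
proof -
  define S where "S = s ` D"
  define W where "W = (\<lambda>z. v z * deriv u2 z - u2 z * deriv v z)"
  define V where "V = potential (\<alpha> (3/2)) (\<beta> (3/2)) (\<gamma> (3/2))"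
  define V3 where "V3 = potential (\<alpha> 3) (\<beta> 3) (\<gamma> 3)"
  have av: "assoc_solution (\<alpha> (3/2)) (\<beta> (3/2)) (\<gamma> (3/2)) v S"
    and au: "assoc_solution (\<alpha> (3/2)) (\<beta> (3/2)) (\<gamma> (3/2)) u2 S"
    and v0: "\<And>x. x \<in> D \<Longrightarrow> v (s x) \<noteq> 0" and X: "\<And>x. x \<in> D \<Longrightarrow> u2 (s x) / v (s x) = x"
    using assms(7) by (auto simp: inverse_quotient_def S_def)
  have hol: "s holomorphic_on D"
    using assms(5) by (simp add: schwarz_solution_def)
  have holv: "v holomorphic_on S" and holu2: "u2 holomorphic_on S"
    using av au by (simp_all add: assoc_solution_def)
  \<comment> \<open>The quotient \<open>u2 / v\<close> is a left inverse of \<open>s\<close>;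
    injectivity and holomorphy make the range \<open>S\<close> open.\<close>
  have "inj_on s D" by (metis X inj_onI)
  then have "open S"
    using open_mapping_thm3[OF hol \<open>open D\<close>] by (simp add: S_def)
  have v0S: "v z \<noteq> 0" and XS: "u2 z / v z \<in> D" if "z \<in> S" for z
    using that v0 X by (auto simp: S_def)
  \<comment> \<open>Obtained by differentiating u2(s(x))/v(s(x)) = x.\<close>
  have sW: "deriv s x * W (s x) = (v (s x))\<^sup>2" if "x \<in> D" for x
  proof -
    have "s x \<in> S" using that by (simp add: S_def)
    note dX = assoc_quotient_derivative(2)[OF \<open>open S\<close> av au this v0[OF that]]
    have "((\<lambda>x. u2 (s x) / v (s x)) has_field_derivative W (s x) / (v (s x))\<^sup>2 * deriv s x) (at x)"
      using DERIV_chain2[OF dX holomorphic_derivI[OF hol \<open>open D\<close> that]] by (simp add: W_def)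
    moreover have "((\<lambda>x. u2 (s x) / v (s x)) has_field_derivative 1) (at x)"
      by (rule has_field_derivative_cong_open[OF DERIV_ident \<open>open D\<close> that]) (simp add: X)
    ultimately have "W (s x) / (v (s x))\<^sup>2 * deriv s x = 1" by (rule DERIV_unique)
    then show ?thesis using v0[OF that] by (simp add: field_simps)
  qed
  have W0: "W (s x) \<noteq> 0" if "x \<in> D" for x
    using sW[OF that] v0[OF that] by auto
  have Q: "Q x = 45/4 * (deriv s x)\<^sup>2 * (V (s x) - V3 (s x))" if "x \<in> D" for x
    using chazy_invariant[OF assms(1,3,5,6) that] assms(8)[OF that] by (simp add: V_def V3_def)
  \<comment> \<open>One identity serves both directions: the two equations differ by the factor
    W^2/v^3, which vanishes nowhere.\<close>
  have key: "deriv (deriv u) (s x) + 1/4 * V3 (s x) * u (s x) =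
      (W (s x))\<^sup>2 / (v (s x))^3 * (deriv (deriv \<rho>) x - 1/45 * Q x * \<rho> x)"
    if \<rho>: "\<rho> holomorphic_on D" and u: "\<And>z. z \<in> S \<Longrightarrow> u z = v z * \<rho> (u2 z / v z)"
      and x: "x \<in> D" for \<rho> u x
  proof -
    have "s x \<in> S" using x by (simp add: S_def)
    have v2: "deriv (deriv v) (s x) = - (1/4 * V (s x) * v (s x))"
      using av \<open>s x \<in> S\<close> by (simp add: assoc_solution_def V_def eq_neg_iff_add_eq_0)
    have u_eq: "u (s x) = v (s x) * \<rho> x" using u[OF \<open>s x \<in> S\<close>] X[OF x] by simp
    have ddu: "deriv (deriv u) (s x) = deriv (deriv v) (s x) * \<rho> x
        + deriv (deriv \<rho>) x * (W (s x))\<^sup>2 / (v (s x))^3"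
      using deriv2_assoc_times_quotient[OF \<open>open S\<close> \<open>open D\<close> av au v0S XS \<rho> u \<open>s x \<in> S\<close>]
      by (simp add: X[OF x] W_def)
    have Q_term: "(W (s x))\<^sup>2 / (v (s x))^3 * (1/45 * Q x * \<rho> x) =
        1/4 * (V (s x) - V3 (s x)) * v (s x) * \<rho> x"
    proof -
      \<comment> \<open>The square of \<open>sW\<close>, with v^4 split so that dividing by v^3
        leaves one factor \<open>v\<close>.\<close>
      have "(W (s x))\<^sup>2 * (deriv s x)\<^sup>2 = (v (s x))^3 * v (s x)"
        using sW[OF x] by (simp add: power2_eq_square power3_eq_cube) algebra
      then have "(W (s x))\<^sup>2 / (v (s x))^3 * (deriv s x)\<^sup>2 = v (s x)"
        using v0[OF x] by (simp add: field_simps)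
      then have "1/4 * (V (s x) - V3 (s x)) * ((W (s x))\<^sup>2 / (v (s x))^3 * (deriv s x)\<^sup>2) * \<rho> x =
          1/4 * (V (s x) - V3 (s x)) * v (s x) * \<rho> x"
        by simp
      then show ?thesis unfolding Q[OF x] by (simp add: mult_ac)
    qed
    show ?thesis
      unfolding right_diff_distrib[of "(W (s x))\<^sup>2 / (v (s x))^3"] Q_term ddu v2 u_eq
      by (simp add: algebra_simps)
  qed
  show ?thesis
  proof (intro allI iffI)
    fix \<rho>
    assume "\<rho> holomorphic_on D \<and> (\<forall>x\<in>D. deriv (deriv \<rho>) x - 1/45 * Q x * \<rho> x = 0)"
    then have \<rho>: "\<rho> holomorphic_on D" "\<And>x. x \<in> D \<Longrightarrow> deriv (deriv \<rho>) x - 1/45 * Q x * \<rho> x = 0"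
      by auto
    \<comment> \<open>This choice is forced by \<rho> = u/v at s(x), with \<open>x\<close> expressed
      as \<open>u2 / v\<close>.\<close>
    define u where "u = (\<lambda>z. v z * \<rho> (u2 z / v z))"
    have "(\<rho> \<circ> (\<lambda>z. u2 z / v z)) holomorphic_on S"
      by (rule holomorphic_on_compose_gen[OF _ \<rho>(1)])
        (use holv holu2 v0S XS in \<open>auto intro!: holomorphic_intros\<close>)
    then have "u holomorphic_on S"
      unfolding u_def using holv by (auto intro!: holomorphic_intros simp: o_def)
    moreover have "deriv (deriv u) (s x) + 1/4 * V3 (s x) * u (s x) = 0" if "x \<in> D" for x
      using key[OF \<rho>(1) _ that, of u] \<rho>(2)[OF that] by (simp add: u_def)
    ultimately have "assoc_solution (\<alpha> 3) (\<beta> 3) (\<gamma> 3) u (s ` D)"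
      by (auto simp: assoc_solution_def S_def V3_def)
    moreover have "\<forall>x\<in>D. \<rho> x = u (s x) / v (s x)"
      by (simp add: u_def X v0)
    ultimately show "\<exists>u. assoc_solution (\<alpha> 3) (\<beta> 3) (\<gamma> 3) u (s ` D) \<and>
        (\<forall>x\<in>D. \<rho> x = u (s x) / v (s x))" by blast
  next
    fix \<rho>
    assume "\<exists>u. assoc_solution (\<alpha> 3) (\<beta> 3) (\<gamma> 3) u (s ` D) \<and> (\<forall>x\<in>D. \<rho> x = u (s x) / v (s x))"
    then obtain u where u: "assoc_solution (\<alpha> 3) (\<beta> 3) (\<gamma> 3) u S"
      and \<rho>: "\<And>x. x \<in> D \<Longrightarrow> \<rho> x = u (s x) / v (s x)"
      by (auto simp: S_def)
    have "u holomorphic_on S" using u by (simp add: assoc_solution_def)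
    then have "(\<lambda>z. u z / v z) holomorphic_on S"
      using holv v0S by (intro holomorphic_intros) auto
    from holomorphic_on_compose_gen[OF hol this] have "(\<lambda>x. u (s x) / v (s x)) holomorphic_on D"
      by (simp add: S_def o_def)
    then have hol\<rho>: "\<rho> holomorphic_on D"
      using \<rho> by (simp cong: holomorphic_cong)
    \<comment> \<open>Every point of \<open>S\<close> is some s(x), and \<open>u2 / v\<close>
      returns that x; so the given \<open>u\<close> has the form required by
      \<open>key\<close>.\<close>
    have "u z = v z * \<rho> (u2 z / v z)" if "z \<in> S" for z
      using that by (auto simp: S_def X \<rho> v0)
    from key[OF hol\<rho> this] have "deriv (deriv \<rho>) x - 1/45 * Q x * \<rho> x = 0" if "x \<in> D" for x
      using u that v0[OF that] W0[OF that] by (auto simp: assoc_solution_def S_def V3_def)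
    with hol\<rho> show "\<rho> holomorphic_on D \<and> (\<forall>x\<in>D. deriv (deriv \<rho>) x - 1/45 * Q x * \<rho> x = 0)"
      by blast
  qed
qed

end
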